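(* In the timed process algebra T-AWN (default version, in which all nodes are input enabled), let $N$ be a partial or complete network expression. Then $N\xrightarrow{\mathrm{tick}}$ if and only if $N\not\xrightarrow{\mathbf{inb}}$, where $N\xrightarrow{\mathbf{inb}}$ means that $N\xrightarrow{a}$ for some action $a$ of the form $R{:}\mathbf{*cast}(m)$, $ip{:}\mathbf{deliver}(d)$ or $\tau$.
   Context: $X\xrightarrow{a}$ means that some transition labelled $a$ leaves $X$. The auxiliary construct $\mathbf{*cast}$ never occurs inside a $+$-context. SEQUENTIAL LEVEL. Valuations $\xi$ are partial maps from variables to data values (types include TIME, DATA, MSG, IP, $\mathcal{P}(\mathrm{IP})$); $\xi(e)\!\downarrow$ means $e$ is defined under $\xi$. $\mathtt{now}$ is a TIME variable and $\xi[\mathtt{now}{+}{+}]$ increments it by 1. Process names have guarded defining equations $X(\vec{\mathtt{var}})\stackrel{def}{=}p$: every call in $p$ occurs inside $[\varphi]q$, $[\![\mathtt{var}:=e]\!]q$, $\alpha.q$ or $\mathbf{unicast}(dest,ms).q\blacktriangleright r$. Sequential expressions: $SP::=X(\vec e)\mid[\varphi]SP\mid[\![\mathtt{var}:=e]\!]SP\mid SP+SP\mid\alpha.SP\mid\mathbf{unicast}(dest,ms).SP\blacktriangleright SP\mid\mathbf{*cast}_{dsts}(m)[n,o].SP\blacktriangleright SP$, with $\alpha::=\mathbf{broadcast}(ms)\mid\mathbf{groupcast}(dests,ms)\mid\mathbf{send}(ms)\mid\mathbf{deliver}(data)\mid\mathbf{receive}(\mathtt{msg})$. Constants $LB,LG,LU>0$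 and $\Delta B,\Delta G,\Delta U\ge0$ are fixed. Process actions: $\tau$, $R{:}\mathbf{*cast}(m)$, $\mathbf{send}(m)$, $\mathbf{deliver}(d)$, $\mathbf{receive}(m)$, wait actions $w_1\in\mathcal{W}=\{\mathrm{w},\mathrm{wr},\mathrm{ws},\mathrm{wrs}\}$, and $R{:}w_1$. Join $\wedge$ on $\mathcal{W}$: $\mathrm{w}$ is neutral, idempotent, $\mathrm{wr}\wedge\mathrm{ws}=\mathrm{wrs}$, and $\mathrm{wrs}$ is absorbing. Sequential rules: - broadcast/groupcast/unicast with defined arguments $\xrightarrow{\tau}$ $\mathbf{*cast}_{\mathrm{IP}}(\xi(ms))[LB,\Delta B].p\blacktriangleright p$ / $\mathbf{*cast}_{\xi(dests)}(\xi(ms))[LG,\Delta G].p\blacktriangleright p$ / $\mathbf{*cast}_{\{\xi(dest)\}}(\xi(ms))[LU,\Delta U].p\blacktriangleright q$. - For all $R$: $\xi,\mathbf{*cast}_{dsts}(m)[n{+}1,o].p\blacktriangleright q\xrightarrow{R:\mathrm{w}}\xi[\mathtt{now}{+}{+}],\mathbf{*cast}_{dsts\cap R}(m)[n,o].p\blacktriangleright q$, and from $[n{+}1,o{+}1]$ to $[n{+}1,o]$ likewise. - $\mathbf{*cast}_{dsts}(m)[0,o].p\blacktriangleright q\xrightarrow{dsts:\mathbf{*cast}(m)}p$ if $dsts\ne\emptyset$, else $\to q$. - $\mathbf{send}(ms).p$ (with $\xi(ms)$ defined) has $\xrightarrow{\mathbf{send}(\xi(ms))}\xi,p$ and $\xrightarrow{\mathrm{ws}}\xi[\mathtt{now}{+}{+}],\mathbf{send}(ms).p$.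 - $\mathbf{deliver}(data).p\xrightarrow{\mathbf{deliver}(\xi(data))}p$. - $\mathbf{receive}(\mathtt{msg}).p$ has $\xrightarrow{\mathbf{receive}(m)}\xi[\mathtt{msg}:=m],p$ for all $m$, and $\xrightarrow{\mathrm{wr}}$ to itself with $\xi[\mathtt{now}{+}{+}]$. - $[\![\mathtt{var}:=e]\!]p\xrightarrow{\tau}\xi[\mathtt{var}:=\xi(e)],p$. - A state whose leading broadcast/groupcast/unicast/send/deliver/assignment/call has an undefined argument does $\xrightarrow{\mathrm{w}}$ to itself with $\xi[\mathtt{now}{+}{+}]$. - A call $X(\vec e)$ with defined arguments inherits the non-wait transitions of $\emptyset[\mathtt{var}_i:=\xi(e_i)],p$, and for each wait action $w_1$ of it does $\xrightarrow{w_1}\xi[\mathtt{now}{+}{+}],X(\vec e)$. - $[\varphi]p\xrightarrow{\tau}\zeta,p$ for each extension $\zeta$ of $\xi$ to the free variables of $\varphi$ satisfying $\varphi$; otherwise $\xrightarrow{\mathrm{w}}\xi[\mathtt{now}{+}{+}],[\varphi]p$. - $p+q$ inherits the non-wait transitions of both summands and does $w_1\wedge w_2$ to $\xi[\mathtt{now}{+}{+}],p'+q'$ when $p\xrightarrow{w_1}p'$ and $q\xrightarrow{w_2}q'$. PARALLEL LEVEL: $PP::=\xi,SP\mid PP\langle\!\langle PP$. Partial function $\langle\!\langle$ on $\mathcal{W}$: $\mathrm{w}\langle\!\langle(\mathrm{w},\mathrm{wr},\mathrm{ws},\mathrm{wrs})=(\mathrm{w},\mathrm{wr},\mathrm{w},\mathrm{wr})$;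 $\mathrm{wr}\langle\!\langle(\mathrm{w},\mathrm{wr})=(\mathrm{w},\mathrm{wr})$; $\mathrm{ws}\langle\!\langle(\mathrm{w},\mathrm{wr},\mathrm{ws},\mathrm{wrs})=(\mathrm{ws},\mathrm{wrs},\mathrm{ws},\mathrm{wrs})$; $\mathrm{wrs}\langle\!\langle(\mathrm{w},\mathrm{wr})=(\mathrm{ws},\mathrm{wrs})$; otherwise undefined. Parallel rules: - $P\xrightarrow{a}P'$ gives $P\langle\!\langle Q\xrightarrow{a}P'\langle\!\langle Q$ for $a$ not a receive action, not in $\mathcal{W}$ and not of the form $R{:}w_1$. - $Q\xrightarrow{a}Q'$ gives $P\langle\!\langle Q\xrightarrow{a}P\langle\!\langle Q'$ for $a$ not a send action, not in $\mathcal{W}$ and not of the form $R{:}w_1$. - $\mathbf{receive}(m)$ of $P$ with $\mathbf{send}(m)$ of $Q$ yields $\tau$. - Time steps $x$ of $P$ and $y$ of $Q$ (each $w_i$ or $R{:}w_i$, the same $R$ if both are transmission actions), with $w_3=w_1\langle\!\langle w_2$ defined, combine to $w_3$ if both are plain wait actions and to $R{:}w_3$ otherwise. NODES: $ip:P:R$ ($ip\in\mathrm{IP}$, $P$ parallel, range $R\subseteq\mathrm{IP}$). Rules: - $P\xrightarrow{dsts:\mathbf{*cast}(m)}P'$ gives $ip:P:R\xrightarrow{dsts:\mathbf{*cast}(m)}ip:P':R$; - $P\xrightarrow{\mathbf{receive}(m)}P'$ gives $\xrightarrow{\{ip\}\neg\emptyset:\mathbf{arrive}(m)}$; - $P\xrightarrow{\mathbf{deliver}(d)}P'$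 gives $\xrightarrow{ip:\mathbf{deliver}(d)}$; - always $ip:P:R\xrightarrow{\emptyset\neg\{ip\}:\mathbf{arrive}(m)}ip:P:R$; - $P\xrightarrow{\tau}P'$ gives $\tau$; - $P\xrightarrow{w_1}P'$ gives $ip:P:R\xrightarrow{\mathrm{tick}}ip:P':R$; - $P\xrightarrow{R:w_1}P'$, where $R$ is the node's own range, gives $\xrightarrow{\mathrm{tick}}$; - $\mathbf{connect}(ip,ip')$ / $\mathbf{disconnect}(ip,ip')$ add $ip'$ to / remove $ip'$ from $R$. Send actions and $R{:}w_1$ with $R$ differing from the range produce no node transitions. NETWORKS: $M::=ip:P:R\mid M\|M$, complete networks $[M]$. Rules: - if $M\xrightarrow{R:\mathbf{*cast}(m)}M'$ and $N\xrightarrow{H\neg K:\mathbf{arrive}(m)}N'$ with $H\subseteq R$ and $K\cap R=\emptyset$, then $M\|N$ and $N\|M$ do $R{:}\mathbf{*cast}(m)$ to $M'\|N'$ resp. $N'\|M'$; - arrive actions of both components combine to $(H\cup H')\neg(K\cup K'):\mathbf{arrive}(m)$; - tick of both components gives tick; - actions $ip{:}\mathbf{deliver}(d)$, $\tau$, $\mathbf{connect}$, $\mathbf{disconnect}$ interleave in $\|$ and pass through $[\cdot]$; - $M\xrightarrow{\mathrm{tick}}M'$ gives $[M]\xrightarrow{\mathrm{tick}}[M']$; - $M\xrightarrow{R:\mathbf{*cast}(m)}M'$ gives $[M]\xrightarrow{\tau}[M']$; - $M\xrightarrow{\{ip\}\neg K:\mathbf{arrive}(\mathbf{newpkt}(d,dip))}M'$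 gives $[M]\xrightarrow{ip:\mathbf{newpkt}(d,dip)}[M']$. Standing assumption (input enabledness, default version): for every node expression $ip:P:R$ and every $m\in\mathrm{MSG}$, $P\xrightarrow{\mathbf{receive}(m)}$. *)

theory Defs
  imports Main
begin

section \<open>Data\<close>

text \<open>
  The universe of data values. \<open>'t\<close>, \<open>'d\<close>, \<open>'m\<close>, \<open>'i\<close> are the carriers of the types TIME, DATA,
  MSG and IP; \<open>'u\<close> collects the values of all further types a specification may use.
\<close>

datatype ('t, 'd, 'm, 'i, 'u) val =
  Time 't | Data 'd | Msg 'm | Ip 'i | IpSet "'i set" | Other 'u

type_synonym ('x, 't, 'd, 'm, 'i, 'u) valuation = "'x \<rightharpoonup> ('t, 'd, 'm, 'i, 'u) val"

text \<open>
  The data language is a parameter of the calculus and is embedded through its semantics: a data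
  expression of type \<open>'a\<close> is a partial function from valuations to \<open>'a\<close>, so \<open>e \<xi>\<close> is the value of
  \<open>e\<close> under \<open>\<xi>\<close>, and \<open>e \<xi> = None\<close> says that \<open>e\<close> is undefined under \<open>\<xi>\<close>. A formula consists of its
  free variables and its satisfaction predicate.
\<close>

type_synonym ('x, 't, 'd, 'm, 'i, 'u, 'a) exp = "('x, 't, 'd, 'm, 'i, 'u) valuation \<Rightarrow> 'a option"

datatype ('x, 't, 'd, 'm, 'i, 'u) formula =
  Formula (free_vars: "'x set") (holds: "('x, 't, 'd, 'm, 'i, 'u) valuation \<Rightarrow> bool")


section \<open>Sequential expressions\<close>

datatype ('x, 't, 'd, 'm, 'i, 'u) prefix =
    Broadcast "('x, 't, 'd, 'm, 'i, 'u, 'm) exp"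
  | Groupcast "('x, 't, 'd, 'm, 'i, 'u, 'i set) exp" "('x, 't, 'd, 'm, 'i, 'u, 'm) exp"
  | Send "('x, 't, 'd, 'm, 'i, 'u, 'm) exp"
  | Deliver "('x, 't, 'd, 'm, 'i, 'u, 'd) exp"
  | Receive 'x

text \<open>
  \<open>Unicast dest ms p q\<close> and \<open>Starcast dsts m n o' p q\<close> continue as \<open>p\<close> in case of a successful
  and as \<open>q\<close> in case of an unsuccessful transmission; the latter is the auxiliary construct for a
  transmission in progress, with at least \<open>n\<close> and at most \<open>n + o'\<close> time units to go.
\<close>

datatype ('x, 't, 'd, 'm, 'i, 'u, 'p) seq =
    Call 'p "('x, 't, 'd, 'm, 'i, 'u, ('t, 'd, 'm, 'i, 'u) val) exp list"
  | Guard "('x, 't, 'd, 'm, 'i, 'u) formula" "('x, 't, 'd, 'm, 'i, 'u, 'p) seq"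
  | Assign 'x "('x, 't, 'd, 'm, 'i, 'u, ('t, 'd, 'm, 'i, 'u) val) exp"
      "('x, 't, 'd, 'm, 'i, 'u, 'p) seq"
  | Choice "('x, 't, 'd, 'm, 'i, 'u, 'p) seq" "('x, 't, 'd, 'm, 'i, 'u, 'p) seq"
  | Prefix "('x, 't, 'd, 'm, 'i, 'u) prefix" "('x, 't, 'd, 'm, 'i, 'u, 'p) seq"
  | Unicast "('x, 't, 'd, 'm, 'i, 'u, 'i) exp" "('x, 't, 'd, 'm, 'i, 'u, 'm) exp"
      "('x, 't, 'd, 'm, 'i, 'u, 'p) seq" "('x, 't, 'd, 'm, 'i, 'u, 'p) seq"
  | Starcast "'i set" 'm nat nat
      "('x, 't, 'd, 'm, 'i, 'u, 'p) seq" "('x, 't, 'd, 'm, 'i, 'u, 'p) seq"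

text \<open>
  Everything a T-AWN specification fixes once and for all. \<open>vals x\<close> is the set of values of the type
  of the variable \<open>x\<close>; the defining equation of a process name \<open>X\<close> is \<open>X(params X) = body X\<close>.
\<close>

record ('x, 't, 'd, 'm, 'i, 'u, 'p) tawn =
  now :: 'x
  vals :: "'x \<Rightarrow> ('t, 'd, 'm, 'i, 'u) val set"
  params :: "'p \<Rightarrow> 'x list"
  body :: "'p \<Rightarrow> ('x, 't, 'd, 'm, 'i, 'u, 'p) seq"
  newpkt :: "'d \<Rightarrow> 'i \<Rightarrow> 'm"
  LB :: nat
  LG :: nat
  LU :: nat
  DB :: nat
  DG :: nat
  DU :: nat

primrec guarded :: "('x, 't, 'd, 'm, 'i, 'u, 'p) seq \<Rightarrow> bool" where
  "guarded (Call X es) \<longleftrightarrow> False"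
| "guarded (Guard \<phi> p) \<longleftrightarrow> True"
| "guarded (Assign x e p) \<longleftrightarrow> True"
| "guarded (Choice p q) \<longleftrightarrow> guarded p \<and> guarded q"
| "guarded (Prefix \<alpha> p) \<longleftrightarrow> True"
| "guarded (Unicast dest ms p q) \<longleftrightarrow> True"
| "guarded (Starcast dsts m n o' p q) \<longleftrightarrow> guarded p \<and> guarded q"

definition well_formed :: "('x, 't, 'd, 'm, 'i, 'u, 'p) tawn \<Rightarrow> bool" where
  "well_formed S \<longleftrightarrow>
     vals S (now S) = range Time \<and> (\<forall>X. guarded (body S X)) \<and> LB S > 0 \<and> LG S > 0 \<and> LU S > 0"

text \<open>
  Subexpressions, where a call is identified with the body of the called process. Hence a process
  that is called inside a choice counts as occurring inside that choice.
\<close>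

inductive subexp ::
  "('x, 't, 'd, 'm, 'i, 'u, 'p) tawn \<Rightarrow> ('x, 't, 'd, 'm, 'i, 'u, 'p) seq \<Rightarrow>
   ('x, 't, 'd, 'm, 'i, 'u, 'p) seq \<Rightarrow> bool" for S where
  refl: "subexp S p p"
| call: "subexp S r (body S X) \<Longrightarrow> subexp S r (Call X es)"
| guard: "subexp S r p \<Longrightarrow> subexp S r (Guard \<phi> p)"
| assign: "subexp S r p \<Longrightarrow> subexp S r (Assign x e p)"
| choice1: "subexp S r p \<Longrightarrow> subexp S r (Choice p q)"
| choice2: "subexp S r q \<Longrightarrow> subexp S r (Choice p q)"
| pre: "subexp S r p \<Longrightarrow> subexp S r (Prefix \<alpha> p)"
| unicast1: "subexp S r p \<Longrightarrow> subexp S r (Unicast dest ms p q)"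
| unicast2: "subexp S r q \<Longrightarrow> subexp S r (Unicast dest ms p q)"
| starcast1: "subexp S r p \<Longrightarrow> subexp S r (Starcast dsts m n o' p q)"
| starcast2: "subexp S r q \<Longrightarrow> subexp S r (Starcast dsts m n o' p q)"

definition no_starcast_in_choice ::
  "('x, 't, 'd, 'm, 'i, 'u, 'p) tawn \<Rightarrow> ('x, 't, 'd, 'm, 'i, 'u, 'p) seq \<Rightarrow> bool" where
  "no_starcast_in_choice S p \<longleftrightarrow>
     (\<forall>q r dsts m n o' s t. subexp S (Choice q r) p \<longrightarrow>
        \<not> subexp S (Starcast dsts m n o' s t) (Choice q r))"


section \<open>Transitions of sequential expressions\<close>

datatype wait = W | WR | WS | WRS

fun wait_join :: "wait \<Rightarrow> wait \<Rightarrow> wait" where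
  "wait_join W w = w"
| "wait_join w W = w"
| "wait_join WR WR = WR"
| "wait_join WS WS = WS"
| "wait_join _ _ = WRS"

datatype ('d, 'm, 'i) action =
    ATau
  | ACast "'i set" 'm
  | ASend 'm
  | ADeliver 'd
  | AReceive 'm
  | AWait wait
  | ATransmit "'i set" wait

text \<open>
  If \<open>now\<close> is undefined, which is possible after unfolding a call, then so is its increment.
\<close>

definition inc_now ::
  "('x, 't::{plus,one}, 'd, 'm, 'i, 'u, 'p) tawn \<Rightarrow> ('x, 't, 'd, 'm, 'i, 'u) valuation \<Rightarrow>
   ('x, 't, 'd, 'm, 'i, 'u) valuation" where
  "inc_now S \<xi> =
     (case \<xi> (now S) of Some (Time t) \<Rightarrow> \<xi>(now S \<mapsto> Time (t + 1)) | _ \<Rightarrow> \<xi>)"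

definition sat_extension ::
  "('x, 't, 'd, 'm, 'i, 'u, 'p) tawn \<Rightarrow> ('x, 't, 'd, 'm, 'i, 'u) formula \<Rightarrow>
   ('x, 't, 'd, 'm, 'i, 'u) valuation \<Rightarrow> ('x, 't, 'd, 'm, 'i, 'u) valuation \<Rightarrow> bool" where
  "sat_extension S \<phi> \<xi> \<zeta> \<longleftrightarrow>
     \<xi> \<subseteq>\<^sub>m \<zeta> \<and> dom \<zeta> = dom \<xi> \<union> free_vars \<phi> \<and>
     (\<forall>x \<in> dom \<zeta> - dom \<xi>. the (\<zeta> x) \<in> vals S x) \<and> holds \<phi> \<zeta>"

text \<open>
  The actions \<open>ATransmit R w\<close> are not wait actions in the sense of the rules for calls and choice.
\<close>

inductive seq_step ::
  "('x, 't::{plus,one}, 'd, 'm, 'i, 'u, 'p) tawn \<Rightarrow>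
   ('x, 't, 'd, 'm, 'i, 'u) valuation \<Rightarrow> ('x, 't, 'd, 'm, 'i, 'u, 'p) seq \<Rightarrow>
   ('d, 'm, 'i) action \<Rightarrow>
   ('x, 't, 'd, 'm, 'i, 'u) valuation \<Rightarrow> ('x, 't, 'd, 'm, 'i, 'u, 'p) seq \<Rightarrow> bool" for S where
  broadcast: "ms \<xi> = Some m \<Longrightarrow>
    seq_step S \<xi> (Prefix (Broadcast ms) p) ATau \<xi> (Starcast UNIV m (LB S) (DB S) p p)"
| broadcast_undef: "ms \<xi> = None \<Longrightarrow>
    seq_step S \<xi> (Prefix (Broadcast ms) p) (AWait W) (inc_now S \<xi>) (Prefix (Broadcast ms) p)"
| groupcast: "dests \<xi> = Some D \<Longrightarrow> ms \<xi> = Some m \<Longrightarrow>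
    seq_step S \<xi> (Prefix (Groupcast dests ms) p) ATau \<xi> (Starcast D m (LG S) (DG S) p p)"
| groupcast_undef: "dests \<xi> = None \<or> ms \<xi> = None \<Longrightarrow>
    seq_step S \<xi> (Prefix (Groupcast dests ms) p) (AWait W)
      (inc_now S \<xi>) (Prefix (Groupcast dests ms) p)"
| unicast: "dest \<xi> = Some i \<Longrightarrow> ms \<xi> = Some m \<Longrightarrow>
    seq_step S \<xi> (Unicast dest ms p q) ATau \<xi> (Starcast {i} m (LU S) (DU S) p q)"
| unicast_undef: "dest \<xi> = None \<or> ms \<xi> = None \<Longrightarrow>
    seq_step S \<xi> (Unicast dest ms p q) (AWait W) (inc_now S \<xi>) (Unicast dest ms p q)"
| starcast_time:
    "seq_step S \<xi> (Starcast dsts m (Suc n) o' p q) (ATransmit R W)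
       (inc_now S \<xi>) (Starcast (dsts \<inter> R) m n o' p q)"
| starcast_opt:
    "seq_step S \<xi> (Starcast dsts m (Suc n) (Suc o') p q) (ATransmit R W)
       (inc_now S \<xi>) (Starcast (dsts \<inter> R) m (Suc n) o' p q)"
| starcast_success: "dsts \<noteq> {} \<Longrightarrow>
    seq_step S \<xi> (Starcast dsts m 0 o' p q) (ACast dsts m) \<xi> p"
| starcast_failure:
    "seq_step S \<xi> (Starcast {} m 0 o' p q) (ACast {} m) \<xi> q"
| send: "ms \<xi> = Some m \<Longrightarrow>
    seq_step S \<xi> (Prefix (Send ms) p) (ASend m) \<xi> p"
| send_wait: "ms \<xi> = Some m \<Longrightarrow>
    seq_step S \<xi> (Prefix (Send ms) p) (AWait WS) (inc_now S \<xi>) (Prefix (Send ms) p)"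
| send_undef: "ms \<xi> = None \<Longrightarrow>
    seq_step S \<xi> (Prefix (Send ms) p) (AWait W) (inc_now S \<xi>) (Prefix (Send ms) p)"
| deliver: "data \<xi> = Some d \<Longrightarrow>
    seq_step S \<xi> (Prefix (Deliver data) p) (ADeliver d) \<xi> p"
| deliver_undef: "data \<xi> = None \<Longrightarrow>
    seq_step S \<xi> (Prefix (Deliver data) p) (AWait W) (inc_now S \<xi>) (Prefix (Deliver data) p)"
| receive:
    "seq_step S \<xi> (Prefix (Receive x) p) (AReceive m) (\<xi>(x \<mapsto> Msg m)) p"
| receive_wait:
    "seq_step S \<xi> (Prefix (Receive x) p) (AWait WR) (inc_now S \<xi>) (Prefix (Receive x) p)"
| assign: "e \<xi> = Some v \<Longrightarrow>
    seq_step S \<xi> (Assign x e p) ATau (\<xi>(x \<mapsto> v)) p"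
| assign_undef: "e \<xi> = None \<Longrightarrow>
    seq_step S \<xi> (Assign x e p) (AWait W) (inc_now S \<xi>) (Assign x e p)"
| call: "map (\<lambda>e. e \<xi>) es = map Some vs \<Longrightarrow>
    seq_step S (Map.empty(params S X [\<mapsto>] vs)) (body S X) a \<zeta> p' \<Longrightarrow> a \<notin> range AWait \<Longrightarrow>
    seq_step S \<xi> (Call X es) a \<zeta> p'"
| call_wait: "map (\<lambda>e. e \<xi>) es = map Some vs \<Longrightarrow>
    seq_step S (Map.empty(params S X [\<mapsto>] vs)) (body S X) (AWait w) \<zeta> p' \<Longrightarrow>
    seq_step S \<xi> (Call X es) (AWait w) (inc_now S \<xi>) (Call X es)"
| call_undef: "\<exists>e \<in> set es. e \<xi> = None \<Longrightarrow>
    seq_step S \<xi> (Call X es) (AWait W) (inc_now S \<xi>) (Call X es)"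
| guard: "sat_extension S \<phi> \<xi> \<zeta> \<Longrightarrow>
    seq_step S \<xi> (Guard \<phi> p) ATau \<zeta> p"
| guard_wait: "\<nexists>\<zeta>. sat_extension S \<phi> \<xi> \<zeta> \<Longrightarrow>
    seq_step S \<xi> (Guard \<phi> p) (AWait W) (inc_now S \<xi>) (Guard \<phi> p)"
| choice1: "seq_step S \<xi> p a \<zeta> p' \<Longrightarrow> a \<notin> range AWait \<Longrightarrow>
    seq_step S \<xi> (Choice p q) a \<zeta> p'"
| choice2: "seq_step S \<xi> q a \<zeta> q' \<Longrightarrow> a \<notin> range AWait \<Longrightarrow>
    seq_step S \<xi> (Choice p q) a \<zeta> q'"
| choice_wait: "seq_step S \<xi> p (AWait w1) \<zeta>1 p' \<Longrightarrow> seq_step S \<xi> q (AWait w2) \<zeta>2 q' \<Longrightarrow>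
    seq_step S \<xi> (Choice p q) (AWait (wait_join w1 w2)) (inc_now S \<xi>) (Choice p' q')"


section \<open>Parallel processes\<close>

datatype ('x, 't, 'd, 'm, 'i, 'u, 'p) par =
    Seq "('x, 't, 'd, 'm, 'i, 'u) valuation" "('x, 't, 'd, 'm, 'i, 'u, 'p) seq"
  | Par "('x, 't, 'd, 'm, 'i, 'u, 'p) par" "('x, 't, 'd, 'm, 'i, 'u, 'p) par"

fun wait_par :: "wait \<Rightarrow> wait \<rightharpoonup> wait" where
  "wait_par W W = Some W"
| "wait_par W WR = Some WR"
| "wait_par W WS = Some W"
| "wait_par W WRS = Some WR"
| "wait_par WR W = Some W"
| "wait_par WR WR = Some WR"
| "wait_par WS W = Some WS"
| "wait_par WS WR = Some WRS"
| "wait_par WS WS = Some WS"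
| "wait_par WS WRS = Some WRS"
| "wait_par WRS W = Some WS"
| "wait_par WRS WR = Some WRS"
| "wait_par _ _ = None"

definition timed :: "('d, 'm, 'i) action \<Rightarrow> bool" where
  "timed a \<longleftrightarrow> (\<exists>w. a = AWait w) \<or> (\<exists>R w. a = ATransmit R w)"

inductive par_step ::
  "('x, 't::{plus,one}, 'd, 'm, 'i, 'u, 'p) tawn \<Rightarrow> ('x, 't, 'd, 'm, 'i, 'u, 'p) par \<Rightarrow>
   ('d, 'm, 'i) action \<Rightarrow> ('x, 't, 'd, 'm, 'i, 'u, 'p) par \<Rightarrow> bool" for S where
  seq: "seq_step S \<xi> p a \<zeta> p' \<Longrightarrow> par_step S (Seq \<xi> p) a (Seq \<zeta> p')"
| left: "par_step S P a P' \<Longrightarrow> a \<notin> range AReceive \<Longrightarrow> \<not> timed a \<Longrightarrow>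
    par_step S (Par P Q) a (Par P' Q)"
| right: "par_step S Q a Q' \<Longrightarrow> a \<notin> range ASend \<Longrightarrow> \<not> timed a \<Longrightarrow>
    par_step S (Par P Q) a (Par P Q')"
| sync: "par_step S P (AReceive m) P' \<Longrightarrow> par_step S Q (ASend m) Q' \<Longrightarrow>
    par_step S (Par P Q) ATau (Par P' Q')"
| wait_wait: "par_step S P (AWait w1) P' \<Longrightarrow> par_step S Q (AWait w2) Q' \<Longrightarrow>
    wait_par w1 w2 = Some w3 \<Longrightarrow> par_step S (Par P Q) (AWait w3) (Par P' Q')"
| wait_transmit: "par_step S P (AWait w1) P' \<Longrightarrow> par_step S Q (ATransmit R w2) Q' \<Longrightarrow>
    wait_par w1 w2 = Some w3 \<Longrightarrow> par_step S (Par P Q) (ATransmit R w3) (Par P' Q')"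
| transmit_wait: "par_step S P (ATransmit R w1) P' \<Longrightarrow> par_step S Q (AWait w2) Q' \<Longrightarrow>
    wait_par w1 w2 = Some w3 \<Longrightarrow> par_step S (Par P Q) (ATransmit R w3) (Par P' Q')"
| transmit_transmit: "par_step S P (ATransmit R w1) P' \<Longrightarrow> par_step S Q (ATransmit R w2) Q' \<Longrightarrow>
    wait_par w1 w2 = Some w3 \<Longrightarrow> par_step S (Par P Q) (ATransmit R w3) (Par P' Q')"

primrec seqs :: "('x, 't, 'd, 'm, 'i, 'u, 'p) par \<Rightarrow> ('x, 't, 'd, 'm, 'i, 'u, 'p) seq set" where
  "seqs (Seq \<xi> p) = {p}"
| "seqs (Par P Q) = seqs P \<union> seqs Q"


section \<open>Networks\<close>

datatype ('x, 't, 'd, 'm, 'i, 'u, 'p) pnet =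
    Node 'i "('x, 't, 'd, 'm, 'i, 'u, 'p) par" "'i set"
  | PNet "('x, 't, 'd, 'm, 'i, 'u, 'p) pnet" "('x, 't, 'd, 'm, 'i, 'u, 'p) pnet"

datatype ('x, 't, 'd, 'm, 'i, 'u, 'p) net =
    Partial "('x, 't, 'd, 'm, 'i, 'u, 'p) pnet"
  | Complete "('x, 't, 'd, 'm, 'i, 'u, 'p) pnet"

text \<open>\<open>NArrive H K m\<close>: message \<open>m\<close> arrives at the nodes in \<open>H\<close> and not at those in \<open>K\<close>.\<close>

datatype ('d, 'm, 'i) naction =
    NCast "'i set" 'm
  | NArrive "'i set" "'i set" 'm
  | NDeliver 'i 'd
  | NTau
  | NTick
  | NConnect 'i 'i
  | NDisconnect 'i 'i
  | NNewpkt 'i 'd 'i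

definition interleaving :: "('d, 'm, 'i) naction \<Rightarrow> bool" where
  "interleaving a \<longleftrightarrow>
     (\<exists>i d. a = NDeliver i d) \<or> a = NTau \<or>
     (\<exists>i j. a = NConnect i j) \<or> (\<exists>i j. a = NDisconnect i j)"

inductive pnet_step ::
  "('x, 't::{plus,one}, 'd, 'm, 'i, 'u, 'p) tawn \<Rightarrow> ('x, 't, 'd, 'm, 'i, 'u, 'p) pnet \<Rightarrow>
   ('d, 'm, 'i) naction \<Rightarrow> ('x, 't, 'd, 'm, 'i, 'u, 'p) pnet \<Rightarrow> bool" for S where
  node_cast: "par_step S P (ACast dsts m) P' \<Longrightarrow>
    pnet_step S (Node i P R) (NCast dsts m) (Node i P' R)"
| node_receive: "par_step S P (AReceive m) P' \<Longrightarrow>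
    pnet_step S (Node i P R) (NArrive {i} {} m) (Node i P' R)"
| node_deliver: "par_step S P (ADeliver d) P' \<Longrightarrow>
    pnet_step S (Node i P R) (NDeliver i d) (Node i P' R)"
| node_miss:
    "pnet_step S (Node i P R) (NArrive {} {i} m) (Node i P R)"
| node_tau: "par_step S P ATau P' \<Longrightarrow>
    pnet_step S (Node i P R) NTau (Node i P' R)"
| node_wait: "par_step S P (AWait w) P' \<Longrightarrow>
    pnet_step S (Node i P R) NTick (Node i P' R)"
| node_transmit: "par_step S P (ATransmit R w) P' \<Longrightarrow>
    pnet_step S (Node i P R) NTick (Node i P' R)"
| node_connect:
    "pnet_step S (Node i P R) (NConnect i j) (Node i P (R \<union> {j}))"
| node_disconnect:
    "pnet_step S (Node i P R) (NDisconnect i j) (Node i P (R - {j}))"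
| cast_left: "pnet_step S M (NCast R m) M' \<Longrightarrow> pnet_step S N (NArrive H K m) N' \<Longrightarrow>
    H \<subseteq> R \<Longrightarrow> K \<inter> R = {} \<Longrightarrow> pnet_step S (PNet M N) (NCast R m) (PNet M' N')"
| cast_right: "pnet_step S M (NCast R m) M' \<Longrightarrow> pnet_step S N (NArrive H K m) N' \<Longrightarrow>
    H \<subseteq> R \<Longrightarrow> K \<inter> R = {} \<Longrightarrow> pnet_step S (PNet N M) (NCast R m) (PNet N' M')"
| arrive: "pnet_step S M (NArrive H K m) M' \<Longrightarrow> pnet_step S N (NArrive H' K' m) N' \<Longrightarrow>
    pnet_step S (PNet M N) (NArrive (H \<union> H') (K \<union> K') m) (PNet M' N')"
| tick: "pnet_step S M NTick M' \<Longrightarrow> pnet_step S N NTick N' \<Longrightarrow>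
    pnet_step S (PNet M N) NTick (PNet M' N')"
| left: "pnet_step S M a M' \<Longrightarrow> interleaving a \<Longrightarrow> pnet_step S (PNet M N) a (PNet M' N)"
| right: "pnet_step S N a N' \<Longrightarrow> interleaving a \<Longrightarrow> pnet_step S (PNet M N) a (PNet M N')"

inductive net_step ::
  "('x, 't::{plus,one}, 'd, 'm, 'i, 'u, 'p) tawn \<Rightarrow> ('x, 't, 'd, 'm, 'i, 'u, 'p) net \<Rightarrow>
   ('d, 'm, 'i) naction \<Rightarrow> ('x, 't, 'd, 'm, 'i, 'u, 'p) net \<Rightarrow> bool" for S where
  partial: "pnet_step S M a M' \<Longrightarrow> net_step S (Partial M) a (Partial M')"
| complete: "pnet_step S M a M' \<Longrightarrow> interleaving a \<Longrightarrow>
    net_step S (Complete M) a (Complete M')"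
| complete_tick: "pnet_step S M NTick M' \<Longrightarrow> net_step S (Complete M) NTick (Complete M')"
| complete_cast: "pnet_step S M (NCast R m) M' \<Longrightarrow>
    net_step S (Complete M) NTau (Complete M')"
| complete_newpkt: "pnet_step S M (NArrive {i} K (newpkt S d j)) M' \<Longrightarrow>
    net_step S (Complete M) (NNewpkt i d j) (Complete M')"

primrec pnet_procs ::
  "('x, 't, 'd, 'm, 'i, 'u, 'p) pnet \<Rightarrow> ('x, 't, 'd, 'm, 'i, 'u, 'p) par set" where
  "pnet_procs (Node i P R) = {P}"
| "pnet_procs (PNet M N) = pnet_procs M \<union> pnet_procs N"

primrec node_procs ::
  "('x, 't, 'd, 'm, 'i, 'u, 'p) net \<Rightarrow> ('x, 't, 'd, 'm, 'i, 'u, 'p) par set" where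
  "node_procs (Partial M) = pnet_procs M"
| "node_procs (Complete M) = pnet_procs M"

definition starcast_restricted ::
  "('x, 't, 'd, 'm, 'i, 'u, 'p) tawn \<Rightarrow> ('x, 't, 'd, 'm, 'i, 'u, 'p) net \<Rightarrow> bool" where
  "starcast_restricted S N \<longleftrightarrow>
     (\<forall>P \<in> node_procs N. \<forall>p \<in> seqs P. no_starcast_in_choice S p)"

definition input_enabled ::
  "('x, 't::{plus,one}, 'd, 'm, 'i, 'u, 'p) tawn \<Rightarrow> ('x, 't, 'd, 'm, 'i, 'u, 'p) net \<Rightarrow> bool" where
  "input_enabled S N \<longleftrightarrow> (\<forall>P \<in> node_procs N. \<forall>m. \<exists>P'. par_step S P (AReceive m) P')"

definition can_do ::
  "('x, 't::{plus,one}, 'd, 'm, 'i, 'u, 'p) tawn \<Rightarrow> ('x, 't, 'd, 'm, 'i, 'u, 'p) net \<Rightarrow>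
   ('d, 'm, 'i) naction \<Rightarrow> bool" where
  "can_do S N a \<longleftrightarrow> (\<exists>N'. net_step S N a N')"

definition can_inb ::
  "('x, 't::{plus,one}, 'd, 'm, 'i, 'u, 'p) tawn \<Rightarrow> ('x, 't, 'd, 'm, 'i, 'u, 'p) net \<Rightarrow> bool" where
  "can_inb S N \<longleftrightarrow>
     (\<exists>a. ((\<exists>R m. a = NCast R m) \<or> (\<exists>i d. a = NDeliver i d) \<or> a = NTau) \<and> can_do S N a)"

end

theory Submission
  imports Defs
begin

text \<open>
  Let \<open>E\<close> be the set of actions enabled in a state. It determines the wait action the state may
  offer: the state can let time pass, in an environment with transmission range \<open>R\<close>, exactly when
  \<open>E\<close> contains no urgent action (an internal step, a transmission or a delivery), and then its only
  wait label records whether a receive and whether a send is enabled. This invariant holds for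
  sequential processes, the exclusion of \<open>Starcast\<close> from choices ensuring that a choice offers
  no transmission step, which could not be combined with the other summand. The operator \<open>Par\<close>
  preserves it because \<open>wait_par\<close> is undefined precisely when a receive on its left can synchronise
  with a send on its right. At the network level, input enabledness guarantees that no cast is
  ever blocked.
\<close>

section \<open>Action sets and the time invariant\<close>

definition urgent :: "('d, 'm, 'i) action set \<Rightarrow> bool" where
  "urgent E \<longleftrightarrow> ATau \<in> E \<or> (\<exists>R m. ACast R m \<in> E) \<or> (\<exists>d. ADeliver d \<in> E)"

fun wait_label :: "bool \<Rightarrow> bool \<Rightarrow> wait" where
  "wait_label False False = W"
| "wait_label True False = WR"
| "wait_label False True = WS"
| "wait_label True True = WRS"

definition offered :: "('d, 'm, 'i) action set \<Rightarrow> wait" where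
  "offered E = wait_label (\<exists>m. AReceive m \<in> E) (\<exists>m. ASend m \<in> E)"

text \<open>Plain waits and transmission steps are merged because parallel composition mixes them;
  \<open>R\<close> later becomes the range of the surrounding node.\<close>

definition passes :: "'i set \<Rightarrow> wait \<Rightarrow> ('d, 'm, 'i) action set \<Rightarrow> bool" where
  "passes R w E \<longleftrightarrow> AWait w \<in> E \<or> ATransmit R w \<in> E"

text \<open>The receive clause lets any enabled send meet a receive of the same message. The
  equivalence is demanded for every \<open>R\<close>, since a transmission in progress offers a step
  for each range.\<close>

definition time_consistent :: "('d, 'm, 'i) action set \<Rightarrow> bool" where
  "time_consistent E \<longleftrightarrow>
     (\<forall>m m'. AReceive m \<in> E \<longrightarrow> AReceive m' \<in> E) \<and>
     (\<forall>R w. passes R w E \<longleftrightarrow> \<not> urgent E \<and> w = offered E)"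

lemma wait_label_join:
  "wait_join (wait_label r s) (wait_label r' s') = wait_label (r \<or> r') (s \<or> s')"
  by (cases r; cases s; cases r'; cases s') auto

text \<open>The result takes its receive flag from the right and its send flag from the left,
  because \<open>Par\<close> hides the receives of its left component and the sends of its right
  one.\<close>

lemma wait_label_par:
  "wait_par (wait_label r s) (wait_label r' s') =
     (if r \<and> s' then None else Some (wait_label r' s))"
  by (cases r; cases s; cases r'; cases s') auto

section \<open>Enabled actions of sequential expressions\<close>

definition seq_acts ::
  "('x, 't::{plus,one}, 'd, 'm, 'i, 'u, 'p) tawn \<Rightarrow>
   ('x, 't, 'd, 'm, 'i, 'u) valuation \<Rightarrow> ('x, 't, 'd, 'm, 'i, 'u, 'p) seq \<Rightarrow>
   ('d, 'm, 'i) action set" where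
  "seq_acts S \<xi> p = {a. \<exists>\<zeta> p'. seq_step S \<xi> p a \<zeta> p'}"

definition par_acts ::
  "('x, 't::{plus,one}, 'd, 'm, 'i, 'u, 'p) tawn \<Rightarrow> ('x, 't, 'd, 'm, 'i, 'u, 'p) par \<Rightarrow>
   ('d, 'm, 'i) action set" where
  "par_acts S P = {a. \<exists>P'. par_step S P a P'}"

inductive_simps seq_step_simps:
  "seq_step S \<xi> (Prefix \<alpha> p) a \<zeta> p'"
  "seq_step S \<xi> (Unicast dest ms p q) a \<zeta> p'"
  "seq_step S \<xi> (Starcast dsts m n o' p q) a \<zeta> p'"
  "seq_step S \<xi> (Assign x e p) a \<zeta> p'"
  "seq_step S \<xi> (Guard \<phi> p) a \<zeta> p'"

inductive_simps seq_step_choice: "seq_step S \<xi> (Choice p q) a \<zeta> p'"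
inductive_simps seq_step_call: "seq_step S \<xi> (Call X es) a \<zeta> p'"
inductive_simps par_step_seq: "par_step S (Seq \<xi> p) a P'"
inductive_simps pnet_step_node: "pnet_step S (Node i P R) a M'"
inductive_simps pnet_step_pnet: "pnet_step S (PNet M N) a M'"
inductive_simps net_step_partial: "net_step S (Partial M) a N'"
inductive_simps net_step_complete: "net_step S (Complete M) a N'"

lemmas time_consistent_defs = time_consistent_def passes_def urgent_def offered_def

lemma seq_acts_broadcast:
  "seq_acts S \<xi> (Prefix (Broadcast ms) p) = {if ms \<xi> = None then AWait W else ATau}"
  by (auto simp: seq_acts_def seq_step_simps)

lemma seq_acts_groupcast:
  "seq_acts S \<xi> (Prefix (Groupcast dests ms) p) =
     {if dests \<xi> = None \<or> ms \<xi> = None then AWait W else ATau}"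
  by (auto simp: seq_acts_def seq_step_simps)

lemma seq_acts_unicast:
  "seq_acts S \<xi> (Unicast dest ms p q) = {if dest \<xi> = None \<or> ms \<xi> = None then AWait W else ATau}"
  by (auto simp: seq_acts_def seq_step_simps)

lemma seq_acts_send:
  "seq_acts S \<xi> (Prefix (Send ms) p) =
     (case ms \<xi> of None \<Rightarrow> {AWait W} | Some m \<Rightarrow> {ASend m, AWait WS})"
  by (auto simp: seq_acts_def seq_step_simps split: option.splits)

lemma seq_acts_deliver:
  "seq_acts S \<xi> (Prefix (Deliver data) p) =
     {case data \<xi> of None \<Rightarrow> AWait W | Some d \<Rightarrow> ADeliver d}"
  by (auto simp: seq_acts_def seq_step_simps split: option.splits)

lemma seq_acts_receive:
  "seq_acts S \<xi> (Prefix (Receive x) p) = insert (AWait WR) (range AReceive)"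
  by (auto simp: seq_acts_def seq_step_simps)

lemma seq_acts_starcast:
  "seq_acts S \<xi> (Starcast dsts m n o' p q) =
     (if n = 0 then {ACast dsts m} else range (\<lambda>R. ATransmit R W))"
  by (cases n; cases o') (auto simp: seq_acts_def seq_step_simps)

lemma seq_acts_assign:
  "seq_acts S \<xi> (Assign x e p) = {if e \<xi> = None then AWait W else ATau}"
  by (auto simp: seq_acts_def seq_step_simps)

lemma seq_acts_guard:
  "seq_acts S \<xi> (Guard \<phi> p) = {if \<exists>\<zeta>. sat_extension S \<phi> \<xi> \<zeta> then ATau else AWait W}"
  by (auto simp: seq_acts_def seq_step_simps)

text \<open>Only plain waits are joined; a transmission step of one summand survives as a non-wait
  action.\<close>

lemma seq_acts_choice:
  "seq_acts S \<xi> (Choice p q) =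
     (seq_acts S \<xi> p \<union> seq_acts S \<xi> q) - range AWait \<union>
     {AWait (wait_join w1 w2) |w1 w2. AWait w1 \<in> seq_acts S \<xi> p \<and> AWait w2 \<in> seq_acts S \<xi> q}"
  (is "?L = ?R")
proof (rule set_eqI)
  fix a
  show "a \<in> ?L \<longleftrightarrow> a \<in> ?R"
    by (cases a) (auto simp: seq_acts_def seq_step_choice, blast)
qed

lemma map_eq_map_SomeD:
  assumes "map f xs = map Some ys" and "x \<in> set xs"
  shows "f x \<noteq> None"
proof -
  have "f x \<in> set (map f xs)" using assms(2) by simp
  then have "f x \<in> set (map Some ys)" unfolding assms(1) .
  then show ?thesis by auto
qed

text \<open>The rule \<open>call_wait\<close> returns to the call whereas \<open>call\<close> moves
  on, but both inherit the label, and the action set forgets targets. The values \<open>vs\<close>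
  are unique by injectivity of \<open>Some\<close>.\<close>

lemma seq_acts_call:
  assumes "map (\<lambda>e. e \<xi>) es = map Some vs"
  shows "seq_acts S \<xi> (Call X es) = seq_acts S (Map.empty(params S X [\<mapsto>] vs)) (body S X)"
    (is "?L = ?R")
proof (rule set_eqI)
  fix a
  have inj: "map Some vs = map Some vs' \<longleftrightarrow> vs' = vs" for vs'
    by (auto dest: map_injective)
  have undef: "(\<exists>e\<in>set es. e \<xi> = None) \<longleftrightarrow> False"
    using map_eq_map_SomeD[OF assms] by blast
  show "a \<in> ?L \<longleftrightarrow> a \<in> ?R"
    unfolding seq_acts_def seq_step_call assms inj undef mem_Collect_eq by (cases a) auto
qed

lemma seq_acts_call_undef:
  assumes "\<exists>e\<in>set es. e \<xi> = None"
  shows "seq_acts S \<xi> (Call X es) = {AWait W}"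
proof -
  have "map (\<lambda>e. e \<xi>) es \<noteq> map Some vs" for vs
    using assms map_eq_map_SomeD[of "\<lambda>e. e \<xi>" es vs] by blast
  with assms show ?thesis unfolding seq_acts_def seq_step_call by auto
qed

lemma defined_args:
  assumes "\<not> (\<exists>e\<in>set es. e \<xi> = None)"
  obtains vs where "map (\<lambda>e. e \<xi>) es = map Some vs"
  using assms by (intro that[of "map (\<lambda>e. the (e \<xi>)) es"]) auto

section \<open>The time invariant for sequential expressions\<close>

text \<open>A transmission label originates only at a \<open>Starcast\<close>; calls and choices
  pass it on, and \<open>subexp\<close> looks through both.\<close>

lemma transmit_imp_starcast:
  assumes "seq_step S \<xi> p a \<zeta> p'" and "a = ATransmit R w"
  shows "\<exists>dsts m n o' s t. subexp S (Starcast dsts m n o' s t) p"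
  using assms by (induction rule: seq_step.induct) (blast intro: subexp.intros)+

text \<open>Phrased as an inclusion of subexpressions, the second hypothesis follows from one
  introduction rule of \<open>subexp\<close>, for summands of a choice and for bodies of calls
  alike.\<close>

lemma no_starcast_in_choice_subexp:
  assumes "no_starcast_in_choice S p" and "\<And>r. subexp S r q \<Longrightarrow> subexp S r p"
  shows "no_starcast_in_choice S q"
  using assms unfolding no_starcast_in_choice_def by blast

lemma no_transmit_in_choice:
  assumes "no_starcast_in_choice S (Choice p q)"
  shows "ATransmit R w \<notin> seq_acts S \<xi> (Choice p q)"
proof
  assume "ATransmit R w \<in> seq_acts S \<xi> (Choice p q)"
  then show False
    using transmit_imp_starcast[OF _ HOL.refl] assms subexp.refl
    unfolding seq_acts_def no_starcast_in_choice_def by blast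
qed

text \<open>A joint wait exists iff both summands have one, that is, iff neither is urgent. Joining
  labels takes the disjunction of their flags, which matches the union of the actions.\<close>

lemma time_consistent_choice:
  assumes p: "time_consistent A" and q: "time_consistent B"
    and E: "E = (A \<union> B) - range AWait \<union>
      {AWait (wait_join w1 w2) |w1 w2. AWait w1 \<in> A \<and> AWait w2 \<in> B}"
    and no_transmit: "\<And>R w. ATransmit R w \<notin> E"
  shows "time_consistent E"
proof -
  have urgent: "urgent E \<longleftrightarrow> urgent A \<or> urgent B"
    by (auto simp: E urgent_def)
  have offered: "offered E = wait_join (offered A) (offered B)"
    unfolding offered_def wait_label_join E
    by (rule arg_cong2[where f = wait_label]) auto
  \<comment> \<open>A transmission in \<open>A\<close> or \<open>B\<close> would survive in
    \<open>E\<close>, so only a plain wait can let either summand pass time.\<close>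
  have A: "AWait w \<in> A \<longleftrightarrow> \<not> urgent A \<and> w = offered A" for w
    using p no_transmit unfolding time_consistent_def passes_def E by blast
  have B: "AWait w \<in> B \<longleftrightarrow> \<not> urgent B \<and> w = offered B" for w
    using q no_transmit unfolding time_consistent_def passes_def E by blast
  have "AWait w \<in> E \<longleftrightarrow> (\<exists>w1 w2. w = wait_join w1 w2 \<and> AWait w1 \<in> A \<and> AWait w2 \<in> B)" for w
    unfolding E by blast
  then have "passes R w E \<longleftrightarrow> \<not> urgent E \<and> w = offered E" for R w
    using no_transmit urgent offered A B unfolding passes_def by auto
  moreover have "AReceive m \<in> E \<Longrightarrow> AReceive m' \<in> E" for m m'
    using p q unfolding time_consistent_def E by blast
  ultimately show ?thesis unfolding time_consistent_def by blast
qed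

text \<open>
  Used twice: for guarded bodies, which yields the invariant for calls, and then for arbitrary
  expressions.
\<close>

lemma time_consistent_seq_if_calls:
  assumes "no_starcast_in_choice S p"
    and "guarded p \<or> (\<forall>\<xi> X es. no_starcast_in_choice S (Call X es) \<longrightarrow>
           time_consistent (seq_acts S \<xi> (Call X es)))"
  shows "time_consistent (seq_acts S \<xi> p)"
  using assms
proof (induction p)
  \<comment> \<open>Apart from calls, this is the only construct whose first step depends on its
    components, so the induction hypotheses are used here alone.\<close>
  case (Choice p q)
  have "no_starcast_in_choice S p" "no_starcast_in_choice S q"
    using Choice.prems(1) by (auto intro: no_starcast_in_choice_subexp subexp.intros)
  with Choice have "time_consistent (seq_acts S \<xi> p)" "time_consistent (seq_acts S \<xi> q)"
    by auto
  then show ?case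
    by (rule time_consistent_choice[OF _ _ seq_acts_choice no_transmit_in_choice[OF Choice.prems(1)]])
next
  case (Prefix \<alpha> p)
  show ?case
    by (cases \<alpha>)
      (auto simp: seq_acts_broadcast seq_acts_groupcast seq_acts_send seq_acts_deliver
        seq_acts_receive time_consistent_defs image_iff split: option.splits)
next
  \<comment> \<open>A call is not guarded, which leaves the second alternative of the
    hypothesis.\<close>
  case (Call X es)
  then show ?case by simp
qed (simp_all add: seq_acts_guard seq_acts_assign seq_acts_unicast seq_acts_starcast
    time_consistent_defs image_iff)

text \<open>One unfolding settles a call: its body is guarded, so the first step of the body does
  not reach a further call.\<close>

lemma time_consistent_seq:
  assumes "\<And>X. guarded (body S X)" and "no_starcast_in_choice S p"
  shows "time_consistent (seq_acts S \<xi> p)"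
proof -
  have "time_consistent (seq_acts S \<xi> (Call X es))"
    if restricted: "no_starcast_in_choice S (Call X es)" for \<xi> X es
  proof (cases "\<exists>e\<in>set es. e \<xi> = None")
    case True
    then show ?thesis by (auto simp: seq_acts_call_undef time_consistent_defs)
  next
    case False
    then obtain vs where "map (\<lambda>e. e \<xi>) es = map Some vs" by (rule defined_args)
    moreover have "no_starcast_in_choice S (body S X)"
      using restricted by (auto intro: no_starcast_in_choice_subexp subexp.call)
    ultimately show ?thesis
      using assms(1) by (simp add: seq_acts_call time_consistent_seq_if_calls)
  qed
  with assms(2) show ?thesis using time_consistent_seq_if_calls by blast
qed

section \<open>The time invariant for parallel processes\<close>

lemma par_acts_seq: "par_acts S (Seq \<xi> p) = seq_acts S \<xi> p"
  by (auto simp: par_acts_def seq_acts_def par_step_seq)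

lemma par_acts_par:
  "par_acts S (Par P Q) =
     {a \<in> par_acts S P. a \<notin> range AReceive \<and> \<not> timed a} \<union>
     {a \<in> par_acts S Q. a \<notin> range ASend \<and> \<not> timed a} \<union>
     {ATau |m. AReceive m \<in> par_acts S P \<and> ASend m \<in> par_acts S Q} \<union>
     {AWait w3 |w1 w2 w3. AWait w1 \<in> par_acts S P \<and> AWait w2 \<in> par_acts S Q \<and>
        wait_par w1 w2 = Some w3} \<union>
     {ATransmit R w3 |R w1 w2 w3. wait_par w1 w2 = Some w3 \<and>
        (AWait w1 \<in> par_acts S P \<and> ATransmit R w2 \<in> par_acts S Q \<or>
         ATransmit R w1 \<in> par_acts S P \<and> AWait w2 \<in> par_acts S Q \<or>
         ATransmit R w1 \<in> par_acts S P \<and> ATransmit R w2 \<in> par_acts S Q)}"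
  (is "?L = ?R")
proof
  show "?L \<subseteq> ?R"
  proof
    fix a
    assume "a \<in> ?L"
    then obtain P' where "par_step S (Par P Q) a P'" by (auto simp: par_acts_def)
    then show "a \<in> ?R"
      unfolding par_acts_def by cases blast+
  qed
  show "?R \<subseteq> ?L"
    unfolding par_acts_def by (blast intro: par_step.intros)
qed

lemma time_consistent_Par:
  assumes P: "time_consistent (par_acts S P)" and Q: "time_consistent (par_acts S Q)"
  shows "time_consistent (par_acts S (Par P Q))"
proof -
  let ?A = "par_acts S P" and ?B = "par_acts S Q" and ?E = "par_acts S (Par P Q)"
  let ?rA = "\<exists>m. AReceive m \<in> ?A" and ?sB = "\<exists>m. ASend m \<in> ?B"
  have receive: "AReceive m \<in> ?E \<longleftrightarrow> AReceive m \<in> ?B" for m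
    by (auto simp: par_acts_par timed_def)
  have send: "ASend m \<in> ?E \<longleftrightarrow> ASend m \<in> ?A" for m
    by (auto simp: par_acts_par timed_def)
  \<comment> \<open>The message received on the left may differ from the one sent on the right; the
    receive clause of the invariant for \<open>P\<close> makes them agree.\<close>
  have tau: "ATau \<in> ?E \<longleftrightarrow> ATau \<in> ?A \<or> ATau \<in> ?B \<or> ?rA \<and> ?sB"
    using P by (auto simp: par_acts_par timed_def time_consistent_def)
  have cast: "ACast R m \<in> ?E \<longleftrightarrow> ACast R m \<in> ?A \<or> ACast R m \<in> ?B" for R m
    by (auto simp: par_acts_par timed_def)
  have deliver: "ADeliver d \<in> ?E \<longleftrightarrow> ADeliver d \<in> ?A \<or> ADeliver d \<in> ?B" for d
    by (auto simp: par_acts_par timed_def)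
  have urgent: "urgent ?E \<longleftrightarrow> urgent ?A \<or> urgent ?B \<or> ?rA \<and> ?sB"
    unfolding urgent_def tau cast deliver by blast
  have offered: "wait_par (offered ?A) (offered ?B) =
      (if ?rA \<and> ?sB then None else Some (offered ?E))"
    unfolding offered_def receive send by (rule wait_label_par)
  have "passes R w ?E \<longleftrightarrow> \<not> urgent ?E \<and> w = offered ?E" for R w
  proof -
    \<comment> \<open>The four timing rules of \<open>Par\<close> collapse into one composition law
      once plain waits and transmissions under \<open>R\<close> are identified.\<close>
    have "passes R w ?E \<longleftrightarrow>
        (\<exists>w1 w2. passes R w1 ?A \<and> passes R w2 ?B \<and> wait_par w1 w2 = Some w)"
      unfolding passes_def par_acts_par timed_def by auto
    \<comment> \<open>By the invariant the witnesses \<open>w1\<close> and \<open>w2\<close> can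
      only be the offered labels.\<close>
    also have "\<dots> \<longleftrightarrow>
        \<not> urgent ?A \<and> \<not> urgent ?B \<and> wait_par (offered ?A) (offered ?B) = Some w"
      using P Q unfolding time_consistent_def by auto
    \<comment> \<open>The pair \<open>?rA\<close> and \<open>?sB\<close> yields an urgent
      synchronisation exactly where \<open>wait_par\<close> is undefined.\<close>
    also have "\<dots> \<longleftrightarrow> \<not> urgent ?E \<and> w = offered ?E"
      unfolding offered urgent by auto
    finally show ?thesis .
  qed
  with Q receive show ?thesis unfolding time_consistent_def by blast
qed

lemma time_consistent_par:
  assumes "\<And>X. guarded (body S X)" and "\<forall>p\<in>seqs P. no_starcast_in_choice S p"
  shows "time_consistent (par_acts S P)"
  using assms(2)
  by (induction P) (auto simp: par_acts_seq time_consistent_seq[OF assms(1)] time_consistent_Par)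

section \<open>Networks of nodes\<close>

definition pnet_can ::
  "('x, 't::{plus,one}, 'd, 'm, 'i, 'u, 'p) tawn \<Rightarrow> ('x, 't, 'd, 'm, 'i, 'u, 'p) pnet \<Rightarrow>
   ('d, 'm, 'i) naction \<Rightarrow> bool" where
  "pnet_can S M a \<longleftrightarrow> (\<exists>M'. pnet_step S M a M')"

definition pnet_inb ::
  "('x, 't::{plus,one}, 'd, 'm, 'i, 'u, 'p) tawn \<Rightarrow> ('x, 't, 'd, 'm, 'i, 'u, 'p) pnet \<Rightarrow>
   bool" where
  "pnet_inb S M \<longleftrightarrow>
     (\<exists>R m. pnet_can S M (NCast R m)) \<or> (\<exists>i d. pnet_can S M (NDeliver i d)) \<or> pnet_can S M NTau"

text \<open>Each node with address in \<open>R\<close> receives \<open>m\<close> and every other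
  node misses it. The conditions on \<open>H\<close> and \<open>K\<close> are those of
  \<open>cast_left\<close> and \<open>cast_right\<close>.\<close>

lemma arrive_possible:
  assumes "\<forall>P\<in>pnet_procs M. \<exists>P'. par_step S P (AReceive m) P'"
  shows "\<exists>H K M'. H \<subseteq> R \<and> K \<inter> R = {} \<and> pnet_step S M (NArrive H K m) M'"
  using assms
proof (induction M)
  case (Node i P R')
  then obtain P' where "par_step S P (AReceive m) P'" by auto
  then have "pnet_step S (Node i P R') (NArrive {i} {} m) (Node i P' R')"
    by (rule node_receive)
  moreover have "pnet_step S (Node i P R') (NArrive {} {i} m) (Node i P R')"
    by (rule node_miss)
  ultimately show ?case by (cases "i \<in> R") blast+
next
  case (PNet M N)
  have "\<exists>H K M'. H \<subseteq> R \<and> K \<inter> R = {} \<and> pnet_step S M (NArrive H K m) M'"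
    and "\<exists>H K N'. H \<subseteq> R \<and> K \<inter> R = {} \<and> pnet_step S N (NArrive H K m) N'"
    using PNet.prems by (intro PNet.IH; simp)+
  then obtain H K M' H' K' N' where
    "H \<subseteq> R" "K \<inter> R = {}" "pnet_step S M (NArrive H K m) M'"
    "H' \<subseteq> R" "K' \<inter> R = {}" "pnet_step S N (NArrive H' K' m) N'"
    by blast
  then have "H \<union> H' \<subseteq> R" "(K \<union> K') \<inter> R = {}"
    "pnet_step S (PNet M N) (NArrive (H \<union> H') (K \<union> K') m) (PNet M' N')"
    by (auto intro: pnet_step.arrive)
  then show ?case by blast
qed

lemma pnet_inb_node: "pnet_inb S (Node i P R) \<longleftrightarrow> urgent (par_acts S P)"
  by (auto simp: pnet_inb_def pnet_can_def pnet_step_node urgent_def par_acts_def)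

text \<open>The two tick rules of a node match the two disjuncts of \<open>passes\<close>, with
  \<open>R\<close> the node's own range.\<close>

lemma pnet_tick_node: "pnet_can S (Node i P R) NTick \<longleftrightarrow> (\<exists>w. passes R w (par_acts S P))"
  unfolding pnet_can_def pnet_step_node passes_def par_acts_def by (simp, blast)

lemma pnet_tick_PNet: "pnet_can S (PNet M N) NTick \<longleftrightarrow> pnet_can S M NTick \<and> pnet_can S N NTick"
  by (auto simp: pnet_can_def pnet_step_pnet interleaving_def)

lemma pnet_can_cast_PNet:
  assumes "\<forall>P\<in>pnet_procs (PNet M N). \<forall>m. \<exists>P'. par_step S P (AReceive m) P'"
  shows "pnet_can S (PNet M N) (NCast R m) \<longleftrightarrow>
    pnet_can S M (NCast R m) \<or> pnet_can S N (NCast R m)" (is "?L \<longleftrightarrow> ?M \<or> ?N")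
proof
  show "?L \<Longrightarrow> ?M \<or> ?N"
    by (auto simp: pnet_can_def pnet_step_pnet interleaving_def)
next
  have "\<exists>H K M'. H \<subseteq> R \<and> K \<inter> R = {} \<and> pnet_step S M (NArrive H K m) M'"
    and "\<exists>H K N'. H \<subseteq> R \<and> K \<inter> R = {} \<and> pnet_step S N (NArrive H K m) N'"
    using assms by (intro arrive_possible; simp)+
  then show "?M \<or> ?N \<Longrightarrow> ?L"
    unfolding pnet_can_def by (blast intro: cast_left cast_right)
qed

lemma pnet_can_interleaving_PNet:
  assumes "a = NTau \<or> a = NDeliver i d"
  shows "pnet_can S (PNet M N) a \<longleftrightarrow> pnet_can S M a \<or> pnet_can S N a"
proof
  show "pnet_can S (PNet M N) a \<Longrightarrow> pnet_can S M a \<or> pnet_can S N a"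
    using assms by (auto simp: pnet_can_def pnet_step_pnet)
  have "interleaving a"
    using assms by (auto simp: interleaving_def)
  then show "pnet_can S M a \<or> pnet_can S N a \<Longrightarrow> pnet_can S (PNet M N) a"
    unfolding pnet_can_def by (blast intro: pnet_step.left pnet_step.right)
qed

lemma pnet_inb_PNet:
  assumes "\<forall>P\<in>pnet_procs (PNet M N). \<forall>m. \<exists>P'. par_step S P (AReceive m) P'"
  shows "pnet_inb S (PNet M N) \<longleftrightarrow> pnet_inb S M \<or> pnet_inb S N"
  unfolding pnet_inb_def pnet_can_cast_PNet[OF assms]
    pnet_can_interleaving_PNet[OF disjI1[OF HOL.refl]]
    pnet_can_interleaving_PNet[OF disjI2[OF HOL.refl]] by blast

text \<open>At a node this is the invariant with \<open>offered\<close> as the witness. In a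
  composition, ticking is a conjunction and instantaneous behaviour a disjunction, so negation
  carries one to the other.\<close>

lemma pnet_tick_iff:
  assumes "\<forall>P\<in>pnet_procs M. time_consistent (par_acts S P)"
    and "\<forall>P\<in>pnet_procs M. \<forall>m. \<exists>P'. par_step S P (AReceive m) P'"
  shows "pnet_can S M NTick \<longleftrightarrow> \<not> pnet_inb S M"
  using assms
proof (induction M)
  case (Node i P R)
  then show ?case by (simp add: pnet_tick_node pnet_inb_node time_consistent_def)
next
  case (PNet M N)
  then show ?case using pnet_inb_PNet[OF PNet.prems(2)] by (simp add: pnet_tick_PNet ball_Un)
qed

section \<open>Partial and complete networks\<close>

lemma can_do_tick: "can_do S (Partial M) NTick \<longleftrightarrow> pnet_can S M NTick"
  "can_do S (Complete M) NTick \<longleftrightarrow> pnet_can S M NTick"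
  by (auto simp: can_do_def pnet_can_def net_step_partial net_step_complete interleaving_def)

text \<open>A complete network shows a cast as \<open>NTau\<close>, so closing a network relabels
  instantaneous behaviour without losing or creating any.\<close>

lemma can_inb: "can_inb S (Partial M) \<longleftrightarrow> pnet_inb S M"
  "can_inb S (Complete M) \<longleftrightarrow> pnet_inb S M"
proof -
  have "can_do S (Partial M) a \<longleftrightarrow> pnet_can S M a" for a
    by (auto simp: can_do_def pnet_can_def net_step_partial)
  then show "can_inb S (Partial M) \<longleftrightarrow> pnet_inb S M"
    unfolding can_inb_def pnet_inb_def by blast
  have "\<not> can_do S (Complete M) (NCast R m)"
    "can_do S (Complete M) (NDeliver i d) \<longleftrightarrow> pnet_can S M (NDeliver i d)"
    "can_do S (Complete M) NTau \<longleftrightarrow>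
       pnet_can S M NTau \<or> (\<exists>R m. pnet_can S M (NCast R m))" for R m i d
    by (auto simp: can_do_def pnet_can_def net_step_complete interleaving_def, blast)
  then show "can_inb S (Complete M) \<longleftrightarrow> pnet_inb S M"
    unfolding can_inb_def pnet_inb_def by blast
qed

theorem theorem3:
  fixes S :: "('x, 't::{plus,one}, 'd, 'm, 'i, 'u, 'p) tawn"
    and N :: "('x, 't, 'd, 'm, 'i, 'u, 'p) net"
  assumes "well_formed S"
    and "starcast_restricted S N"
    and "input_enabled S N"
  shows "can_do S N NTick \<longleftrightarrow> \<not> can_inb S N"
proof -
  have "\<forall>P\<in>node_procs N. time_consistent (par_acts S P)"
    using assms(1,2) time_consistent_par unfolding well_formed_def starcast_restricted_def by blast
  then show ?thesis
    using assms(3) pnet_tick_iff unfolding input_enabled_def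
    by (cases N) (simp_all add: can_do_tick can_inb)
qed

end
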